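(* Let $t\geq 2$ and $r\geq 1$ be integers and $a,b>0$ reals. Let $Q_t$ be the right prismatic polytope (vertex set) obtained as the Cartesian product of a line segment of length $a$ and a $(t-1)$-dimensional regular simplex with side length $b$. Let \[d=(6(t-1)-1)r+3(t-1)(r+1)+2(t-1)\binom{6(t-1)}{2}+3.\] Then every coloring of $\mathbb{E}^d$ with $r$ colors contains a rainbow configuration congruent to $Q_t$ or a monochromatic configuration congruent to $Q_t$.
   Context: $\mathbb{E}^d$ is $d$-dimensional Euclidean space. For $K_1\subset\mathbb{E}^{n_1}$, $K_2\subset\mathbb{E}^{n_2}$, $K_1\ast K_2=\{(x,y): x\in K_1, y\in K_2\}\subset\mathbb{E}^{n_1+n_2}$. A point set is monochromatic if all its points share a color and rainbow if all its points have pairwise distinct colors. *)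

theory Defs
  imports "HOL-Analysis.Analysis"
begin

definition regular_simplex :: "nat \<Rightarrow> real \<Rightarrow> 'a::euclidean_space set \<Rightarrow> bool" where
  "regular_simplex n b S \<longleftrightarrow>
     (\<exists>V. \<not> affine_dependent V \<and> card V = n + 1 \<and>
          (\<forall>x\<in>V. \<forall>y\<in>V. x \<noteq> y \<longrightarrow> dist x y = b) \<and> S = convex hull V)"

text \<open>The prism lives in the product space \<^typ>\<open>real \<times> 'b\<close>, whose metric is the Euclidean one,
  so the segment and the simplex lie in orthogonal factors.\<close>

definition right_prism_vertices :: "nat \<Rightarrow> real \<Rightarrow> real \<Rightarrow> (real \<times> 'b::euclidean_space) set \<Rightarrow> bool" where
  "right_prism_vertices t a b Q \<longleftrightarrow>
     (\<exists>p q S. dist p q = a \<and> regular_simplex (t - 1) b S \<and>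
          Q = {x. x extreme_point_of (closed_segment p q \<times> S)})"

text \<open>The two sets may lie in Euclidean spaces of different dimensions.\<close>

definition congruent_sets :: "'a::metric_space set \<Rightarrow> 'b::metric_space set \<Rightarrow> bool" where
  "congruent_sets A B \<longleftrightarrow>
     (\<exists>f. bij_betw f A B \<and> (\<forall>x\<in>A. \<forall>y\<in>A. dist (f x) (f y) = dist x y))"

definition monochromatic :: "('a \<Rightarrow> 'c) \<Rightarrow> 'a set \<Rightarrow> bool" where
  "monochromatic c S \<longleftrightarrow> (\<forall>x\<in>S. \<forall>y\<in>S. c x = c y)"

definition rainbow :: "('a \<Rightarrow> 'c) \<Rightarrow> 'a set \<Rightarrow> bool" where
  "rainbow c S \<longleftrightarrow> (\<forall>x\<in>S. \<forall>y\<in>S. x \<noteq> y \<longrightarrow> c x \<noteq> c y)"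

end

theory Submission imports Defs begin

text \<open>
  Write \<open>s = t - 1\<close>. Orthogonal basis vectors scaled by \<open>a / sqrt 2\<close> and \<open>b / sqrt 2\<close> span a grid
  of points in which any two rows and any \<open>t\<close> columns form a copy of the prism. Suppose that no
  copy in the grid is monochromatic or rainbow, and view each column as an edge between the colours
  that two given rows assign to it. The loops of this graph number at most \<open>s\<close> per colour, and
  it has no matching of size \<open>t\<close>, so \<open>2 * s\<close> colours cover all other edges. Hence one of any
  two rows has a popular colour, and so has every row with at most one exception. By pigeonhole
  \<open>6 * s\<close> rows share a popular colour; the sets of columns on which they use it intersect pairwise
  in at most \<open>s\<close> columns, which by Bonferroni's inequality is too much for the given number of columns.
\<close>

section \<open>Combinatorics of colour classes\<close>

text \<open>Induction on \<open>I\<close>: a new set meets the union of the earlier ones in at most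
  \<open>s * card I\<close> points, and these overlaps add up to the binomial term.\<close>

lemma sum_card_le_card_Union:
  assumes "finite I" and "\<And>i. i \<in> I \<Longrightarrow> finite (F i)"
    and "\<And>i j. \<lbrakk>i \<in> I; j \<in> I; i \<noteq> j\<rbrakk> \<Longrightarrow> card (F i \<inter> F j) \<le> s"
  shows "(\<Sum>i\<in>I. card (F i)) \<le> card (\<Union>i\<in>I. F i) + s * (card I choose 2)"
  using assms
proof (induction I rule: finite_induct)
  case empty
  then show ?case by simp
next
  case (insert k I)
  let ?U = "\<Union>i\<in>I. F i"
  have fin: "finite (F k)" "finite ?U" using insert by auto
  have "card (F k \<inter> ?U) = card (\<Union>i\<in>I. F k \<inter> F i)" by (simp only: Int_UN_distrib)
  also have "\<dots> \<le> (\<Sum>i\<in>I. card (F k \<inter> F i))" using insert.hyps(1) by (rule card_UN_le)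
  also have "\<dots> \<le> (\<Sum>i\<in>I. s)"
  proof (rule sum_mono)
    fix i assume "i \<in> I"
    then show "card (F k \<inter> F i) \<le> s" using insert.hyps(2) insert.prems(2)[of k i] by auto
  qed
  finally have "card (F k \<inter> ?U) \<le> s * card I" by (simp add: mult.commute)
  moreover have "card (F k) + card ?U = card (F k \<union> ?U) + card (F k \<inter> ?U)"
    using fin by (rule card_Un_Int)
  moreover have "(\<Sum>i\<in>I. card (F i)) \<le> card ?U + s * (card I choose 2)"
    using insert by auto
  moreover have "s * (card (insert k I) choose 2) = s * card I + s * (card I choose 2)"
    using insert.hyps by (simp add: numeral_2_eq_2 distrib_left)
  ultimately show ?case using insert.hyps by simp
qed

text \<open>With \<open>j\<close> as an edge joining \<open>f j\<close> and \<open>g j\<close>, the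
  at most \<open>2 * s\<close> end colours of a maximum matching meet every edge that is not a loop.
  Each such colour has a class in both rows, so averaging over at most \<open>4 * s\<close> classes
  yields a large one.\<close>

lemma two_rows_popular_colour:
  fixes f g :: "'j \<Rightarrow> 'c"
  assumes "finite J" and "finite X" and "f ` J \<subseteq> X" and "g ` J \<subseteq> X" and "X \<noteq> {}"
    and mono: "\<And>x. card {j\<in>J. f j = x \<and> g j = x} \<le> s"
    and rainbow: "\<And>T. \<lbrakk>T \<subseteq> J; inj_on f T; inj_on g T; f ` T \<inter> g ` T = {}\<rbrakk> \<Longrightarrow> card T \<le> s"
  shows "\<exists>x\<in>X. card J \<le> s * card X + 4 * s * card {j\<in>J. f j = x}
              \<or> card J \<le> s * card X + 4 * s * card {j\<in>J. g j = x}"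
proof -
  \<comment> \<open>The \<open>good\<close> sets are the matchings without loops: all
    \<open>2 * card T\<close> end colours are distinct.\<close>
  define good where "good T \<longleftrightarrow> T \<subseteq> J \<and> inj_on f T \<and> inj_on g T \<and> f ` T \<inter> g ` T = {}" for T
  have "good {}" by (simp add: good_def)
  moreover have "\<forall>T. good T \<longrightarrow> card T < Suc s" using rainbow by (auto simp: good_def less_Suc_eq_le)
  ultimately obtain T where T: "good T" and max: "\<And>U. good U \<Longrightarrow> card U \<le> card T"
    using ex_has_greatest_nat[of good "{}" card "Suc s"] by (metis less_imp_le)
  have TJ: "T \<subseteq> J" and finT: "finite T" using T assms(1) finite_subset by (auto simp: good_def)
  define C where "C = f ` T \<union> g ` T"
  have CX: "C \<subseteq> X" and finC: "finite C" using TJ assms(3,4) finT by (auto simp: C_def)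
  have "card T \<le> s" using T rainbow by (auto simp: good_def)
  then have cardC: "card C \<le> 2 * s"
    using card_Un_le[of "f ` T" "g ` T"] card_image_le[OF finT, of f] card_image_le[OF finT, of g]
    unfolding C_def by linarith
  let ?A = "\<lambda>x. {j\<in>J. f j = x}" and ?B = "\<lambda>x. {j\<in>J. g j = x}"
    and ?L = "\<lambda>x. {j\<in>J. f j = x \<and> g j = x}"
  \<comment> \<open>An edge that is no loop and avoids \<open>C\<close> would extend the matching
    \<open>T\<close>, against its maximality.\<close>
  have cover: "j \<in> (\<Union>x\<in>X. ?L x) \<union> (\<Union>x\<in>C. ?A x \<union> ?B x)" if j: "j \<in> J" for j
  proof (rule ccontr)
    assume "\<not> ?thesis"
    then have *: "f j \<noteq> g j" "f j \<notin> C" "g j \<notin> C" using j assms(3,4) by auto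
    then have "j \<notin> T" by (auto simp: C_def)
    moreover have "good (insert j T)" using T * j by (auto simp: good_def C_def)
    ultimately show False using max[of "insert j T"] finT by simp
  qed
  have loops: "card (\<Union>x\<in>X. ?L x) \<le> s * card X"
  proof -
    have "card (\<Union>x\<in>X. ?L x) \<le> (\<Sum>x\<in>X. card (?L x))" using assms(2) by (rule card_UN_le)
    also have "\<dots> \<le> (\<Sum>x\<in>X. s)" by (rule sum_mono) (rule mono)
    finally show ?thesis by (simp add: mult.commute)
  qed
  have "card J \<le> card ((\<Union>x\<in>X. ?L x) \<union> (\<Union>x\<in>C. ?A x \<union> ?B x))"
    using cover assms(1,2) finC by (intro card_mono) auto
  then have cardJ: "card J \<le> s * card X + card (\<Union>x\<in>C. ?A x \<union> ?B x)"
    using loops card_Un_le[of "\<Union>x\<in>X. ?L x" "\<Union>x\<in>C. ?A x \<union> ?B x"] by linarith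
  show ?thesis
  proof (rule ccontr)
    assume neg: "\<not> ?thesis"
    \<comment> \<open>Averaging the strict bounds for the two classes turns the factor
      \<open>4 * s\<close> into \<open>2 * s\<close>. The subtraction does not truncate, since
      \<open>neg\<close> forces \<open>s * card X < card J\<close>.\<close>
    have small: "2 * s * card (?A x \<union> ?B x) < card J - s * card X" if "x \<in> C" for x
    proof -
      have "s * card X + 4 * s * card (?A x) < card J" "s * card X + 4 * s * card (?B x) < card J"
        using neg that CX by (auto simp: not_le)
      moreover have "2 * s * card (?A x \<union> ?B x) \<le> 2 * s * card (?A x) + 2 * s * card (?B x)"
        using mult_le_mono2[OF card_Un_le[of "?A x" "?B x"], of "2 * s"] by (simp add: distrib_left)
      ultimately show ?thesis by linarith
    qed
    show False
    \<comment> \<open>The strict sum below needs a nonempty \<open>C\<close>. If \<open>C\<close> is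
      empty, all edges are loops and any colour of \<open>X\<close> contradicts
      \<open>neg\<close>.\<close>
    proof (cases "C = {}")
      case True
      then have "card J \<le> s * card X" using cardJ by simp
      then show False using neg assms(5) by (auto simp: not_le)
    next
      case False
      have "2 * s * card (\<Union>x\<in>C. ?A x \<union> ?B x) \<le> 2 * s * (\<Sum>x\<in>C. card (?A x \<union> ?B x))"
        using card_UN_le[OF finC] by (rule mult_le_mono2)
      also have "\<dots> = (\<Sum>x\<in>C. 2 * s * card (?A x \<union> ?B x))" by (rule sum_distrib_left)
      also have "\<dots> < (\<Sum>x\<in>C. card J - s * card X)" using finC False small by (rule sum_strict_mono)
      also have "\<dots> \<le> 2 * s * (card J - s * card X)" using cardC by simp
      finally have "card (\<Union>x\<in>C. ?A x \<union> ?B x) < card J - s * card X" by simp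
      then show False using cardJ by linarith
    qed
  qed
qed

text \<open>The row bound leaves \<open>(6 * s - 1) * card X + 1\<close> rows after one exception,
  enough for \<open>6 * s\<close> of them to share a popular colour. Their classes have total size
  at least 3/2 of \<open>card J - s * card X\<close>, while the Bonferroni bound allows only
  \<open>card J + s * ((6 * s) choose 2)\<close>; the column bound is where these collide.\<close>

lemma grid_monochromatic_or_rainbow:
  fixes col :: "'i \<Rightarrow> 'j \<Rightarrow> 'c"
  assumes "finite I" and "finite J" and "finite X" and "X \<noteq> {}" and "s \<ge> 1"
    and col: "\<And>i j. \<lbrakk>i \<in> I; j \<in> J\<rbrakk> \<Longrightarrow> col i j \<in> X"
    and rows: "(6 * s - 1) * card X + 2 \<le> card I"
    and columns: "3 * s * card X + 2 * s * ((6 * s) choose 2) < card J"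
  obtains i k T where "i \<in> I" "k \<in> I" "i \<noteq> k" "T \<subseteq> J" "card T = s + 1"
    "(\<exists>x. \<forall>j\<in>T. col i j = x \<and> col k j = x) \<or> inj_on (\<lambda>(l, j). col l j) ({i, k} \<times> T)"
proof (rule ccontr)
  assume contra: "\<not> thesis"
  note wit = that
  have mono: "card {j\<in>J. col i j = x \<and> col k j = x} \<le> s" if "i \<in> I" "k \<in> I" "i \<noteq> k" for i k x
  proof (rule ccontr)
    assume "\<not> ?thesis"
    then have "s + 1 \<le> card {j\<in>J. col i j = x \<and> col k j = x}" by simp
    then obtain T where "T \<subseteq> {j\<in>J. col i j = x \<and> col k j = x}" "card T = s + 1"
      by (rule obtain_subset_with_card_n)
    then show False using contra wit[of i k T] \<open>i \<in> I\<close> \<open>k \<in> I\<close> \<open>i \<noteq> k\<close> by blast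
  qed
  have rainbow: "card T \<le> s"
    if "i \<in> I" "k \<in> I" "i \<noteq> k" "T \<subseteq> J" "inj_on (col i) T" "inj_on (col k) T"
      "col i ` T \<inter> col k ` T = {}" for i k T
  proof (rule ccontr)
    assume "\<not> ?thesis"
    then have "s + 1 \<le> card T" by simp
    then obtain U where U: "U \<subseteq> T" "card U = s + 1" by (rule obtain_subset_with_card_n)
    have "inj_on (\<lambda>(l, j). col l j) ({i, k} \<times> U)"
    proof (rule inj_onI, clarify)
      fix l j l' j'
      assume *: "l \<in> {i, k}" "j \<in> U" "l' \<in> {i, k}" "j' \<in> U" "col l j = col l' j'"
      then have jT: "j \<in> T" "j' \<in> T" using U by auto
      then have "l = l'" using * that(7) by (metis IntI empty_iff imageI insertE singletonD)
      moreover have "j = j'" using * \<open>l = l'\<close> jT that(5,6) by (auto dest: inj_onD)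
      ultimately show "l = l' \<and> j = j'" by simp
    qed
    then show False using contra wit[of i k U] that(1-4) U by blast
  qed
  \<comment> \<open>A division-free form of: the class of \<open>x\<close> in row \<open>i\<close>
    has at least \<open>(card J - s * card X) / (4 * s)\<close> columns.\<close>
  define popular where
    "popular i x \<longleftrightarrow> card J \<le> s * card X + 4 * s * card {j\<in>J. col i j = x}" for i x
  define G where "G = {i\<in>I. \<exists>x\<in>X. popular i x}"
  have one_popular: "i \<in> G \<or> k \<in> G" if ik: "i \<in> I" "k \<in> I" "i \<noteq> k" for i k
  proof -
    have "\<exists>x\<in>X. popular i x \<or> popular k x"
      unfolding popular_def
    proof (rule two_rows_popular_colour[OF assms(2,3)])
      show "col i ` J \<subseteq> X" "col k ` J \<subseteq> X" using col ik by auto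
    qed (use assms(4) mono[OF ik] rainbow[OF ik] in auto)
    then show ?thesis using ik by (auto simp: G_def)
  qed
  have GI: "G \<subseteq> I" by (auto simp: G_def)
  then have finG: "finite G" using assms(1) finite_subset by blast
  have "card (I - G) \<le> 1"
    using one_popular assms(1) by (auto simp: card_le_Suc0_iff_eq)
  then have cardG: "(6 * s - 1) * card X < card G"
    using rows card_Diff_subset[OF finG GI] by linarith
  have "\<forall>i\<in>G. \<exists>x. x \<in> X \<and> popular i x" by (auto simp: G_def)
  then obtain h where h: "\<And>i. i \<in> G \<Longrightarrow> h i \<in> X \<and> popular i (h i)" by metis
  obtain y where y: "y \<in> X" "card G \<le> card (h -` {y} \<inter> G) * card X"
    using pigeonhole_card[of h G X] h finG assms(3,4) by auto
  \<comment> \<open>Cancelling \<open>card X\<close> leaves a fibre of size above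
    \<open>6 * s - 1\<close>, hence at least \<open>6 * s\<close>.\<close>
  have "(6 * s - 1) * card X < card (h -` {y} \<inter> G) * card X" using cardG y(2) by linarith
  then have "6 * s \<le> card (h -` {y} \<inter> G)" by (simp only: mult_less_cancel2) linarith
  then obtain R where R: "R \<subseteq> h -` {y} \<inter> G" "card R = 6 * s" by (rule obtain_subset_with_card_n)
  have finR: "finite R" and RI: "R \<subseteq> I" using R(1) finG GI by (auto intro: finite_subset)
  let ?F = "\<lambda>i. {j\<in>J. col i j = y}"
  have inter: "card (?F i \<inter> ?F k) \<le> s" if "i \<in> R" "k \<in> R" "i \<noteq> k" for i k
  proof -
    have "?F i \<inter> ?F k = {j\<in>J. col i j = y \<and> col k j = y}" by auto
    then show ?thesis using mono[of i k y] that RI by auto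
  qed
  have "card (\<Union>i\<in>R. ?F i) \<le> card J" using assms(2) by (intro card_mono) auto
  then have bonf: "(\<Sum>i\<in>R. card (?F i)) \<le> card J + s * ((6 * s) choose 2)"
    using sum_card_le_card_Union[of R ?F s] finR inter assms(2) R(2) by simp
  have "(\<Sum>i\<in>R. card J) \<le> (\<Sum>i\<in>R. s * card X + 4 * s * card (?F i))"
  proof (rule sum_mono)
    fix i assume "i \<in> R"
    then show "card J \<le> s * card X + 4 * s * card (?F i)" using R(1) h[of i] by (auto simp: popular_def)
  qed
  also have "\<dots> = 6 * s * (s * card X) + 4 * s * (\<Sum>i\<in>R. card (?F i))"
    using R(2) by (simp add: sum.distrib sum_distrib_left)
  also have "\<dots> \<le> 6 * s * (s * card X) + 4 * s * (card J + s * ((6 * s) choose 2))"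
    using bonf by (intro add_left_mono mult_le_mono2)
  \<comment> \<open>The left side is \<open>card R = 6 * s\<close> copies of \<open>card J\<close>,
    so a common factor \<open>s\<close> can be cancelled because \<open>s \<ge> 1\<close>.\<close>
  finally have "s * (6 * card J) \<le> s * (6 * (s * card X) + 4 * (card J + s * ((6 * s) choose 2)))"
    using R(2) by (simp add: algebra_simps)
  then have "6 * card J \<le> 6 * (s * card X) + 4 * (card J + s * ((6 * s) choose 2))"
    using assms(5) by simp
  then show False using columns by (simp add: mult.assoc)
qed

section \<open>Metric geometry of the prism and of the grid\<close>

text \<open>Extreme points are singleton faces, and a product is a face of a product of convex sets
  exactly when its factors are faces; so the vertices are the pairs of segment ends and simplex
  vertices.\<close>

lemma right_prism_verticesE:
  fixes Q :: "(real \<times> 'b::euclidean_space) set"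
  assumes "right_prism_vertices t a b Q" and "t \<ge> 1"
  obtains p q V where "dist p q = a" "card V = t" "Q = {p, q} \<times> V"
    "\<And>x y. \<lbrakk>x \<in> V; y \<in> V; x \<noteq> y\<rbrakk> \<Longrightarrow> dist x y = b"
proof -
  from assms(1) obtain p q S where pq: "dist p q = a" and S: "regular_simplex (t - 1) b S"
    and Q: "Q = {x. x extreme_point_of (closed_segment p q \<times> S)}"
    unfolding right_prism_vertices_def by blast
  from S obtain V where V: "\<not> affine_dependent V" "card V = t - 1 + 1" "S = convex hull V"
    and V_dist: "\<forall>x\<in>V. \<forall>y\<in>V. x \<noteq> y \<longrightarrow> dist x y = b"
    unfolding regular_simplex_def by blast
  have "(u, v) extreme_point_of (closed_segment p q \<times> S) \<longleftrightarrow> u \<in> {p, q} \<and> v \<in> V" for u v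
  proof -
    have "(u, v) extreme_point_of (closed_segment p q \<times> S) \<longleftrightarrow>
        ({u} \<times> {v}) face_of (closed_segment p q \<times> S)"
      by (simp add: face_of_singleton)
    also have "\<dots> \<longleftrightarrow> u extreme_point_of closed_segment p q \<and> v extreme_point_of S"
      by (subst face_of_Times_eq) (simp add: face_of_singleton)
    also have "\<dots> \<longleftrightarrow> u \<in> {p, q} \<and> v \<in> V"
      using V by (simp add: extreme_point_of_segment extreme_point_of_convex_hull_affine_independent)
    finally show ?thesis .
  qed
  then have "Q = {p, q} \<times> V" unfolding Q by auto
  then show thesis using that pq V(2) V_dist assms(2) by auto
qed

lemma dist_orthogonal_sum:
  assumes "orthogonal (x - x') (y - y')"
  shows "dist (x + y) (x' + y') = sqrt ((dist x x')\<^sup>2 + (dist y y')\<^sup>2)"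
proof -
  have "(x + y) - (x' + y') = (x - x') + (y - y')" by simp
  then show ?thesis
    using norm_add_Pythagorean[OF assms] by (metis dist_norm norm_ge_zero real_sqrt_unique)
qed

text \<open>Distinct basis vectors are at distance \<open>sqrt 2\<close>, which the scaling
  cancels.\<close>

lemma dist_scaled_Basis:
  assumes "i \<in> Basis" and "j \<in> Basis" and "i \<noteq> j" and "a \<ge> 0"
  shows "dist ((a / sqrt 2) *\<^sub>R i) ((a / sqrt 2) *\<^sub>R j) = a"
proof -
  have "(norm (i - j))\<^sup>2 = 2"
    using assms by (simp add: power2_norm_eq_inner inner_diff_left inner_diff_right inner_Basis)
  then have "norm (i - j) = sqrt 2" by (metis norm_ge_zero real_sqrt_unique)
  then show ?thesis using assms(4)
    by (simp add: dist_norm flip: scaleR_diff_right)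
qed

text \<open>The first component selects the row, the second the column. If rows and columns come
  from disjoint parts of the basis, the two summands vary in orthogonal subspaces, as the factors of
  the prism do.\<close>

definition grid_point :: "real \<Rightarrow> real \<Rightarrow> 'e \<times> 'e \<Rightarrow> 'e::euclidean_space" where
  "grid_point a b = (\<lambda>(i, j). (a / sqrt 2) *\<^sub>R i + (b / sqrt 2) *\<^sub>R j)"

lemma dist_grid_point:
  fixes I J :: "'e::euclidean_space set"
  assumes "I \<subseteq> Basis" and "J \<subseteq> Basis" and "I \<inter> J = {}" and "a \<ge> 0" and "b \<ge> 0"
    and "i \<in> I" and "i' \<in> I" and "j \<in> J" and "j' \<in> J"
  shows "dist (grid_point a b (i, j)) (grid_point a b (i', j')) =
    sqrt ((if i = i' then 0 else a)\<^sup>2 + (if j = j' then 0 else b)\<^sup>2)"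
proof -
  have "k \<bullet> l = 0" if "k \<in> I" "l \<in> J" for k l
    using that assms(1-3) by (metis IntI empty_iff inner_Basis subsetD)
  then have "orthogonal ((a / sqrt 2) *\<^sub>R i - (a / sqrt 2) *\<^sub>R i') ((b / sqrt 2) *\<^sub>R j - (b / sqrt 2) *\<^sub>R j')"
    using assms(6-9) by (simp add: orthogonal_def inner_diff_left inner_diff_right)
  moreover have "dist ((a / sqrt 2) *\<^sub>R i) ((a / sqrt 2) *\<^sub>R i') = (if i = i' then 0 else a)"
    using dist_scaled_Basis[of i i' a] assms by auto
  moreover have "dist ((b / sqrt 2) *\<^sub>R j) ((b / sqrt 2) *\<^sub>R j') = (if j = j' then 0 else b)"
    using dist_scaled_Basis[of j j' b] assms by auto
  ultimately show ?thesis by (simp add: grid_point_def dist_orthogonal_sum)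
qed

text \<open>On both sides a distance depends only on which of the two coordinates agree, so any
  bijections from segment ends to rows and from simplex vertices to columns combine to an
  isometry.\<close>

lemma prism_congruent_grid:
  fixes I J :: "'e::euclidean_space set" and Q :: "(real \<times> 'b::euclidean_space) set"
  assumes "right_prism_vertices t a b Q" and "t \<ge> 1" and "a > 0" and "b > 0"
    and "I \<subseteq> Basis" and "J \<subseteq> Basis" and "I \<inter> J = {}"
    and "i \<in> I" and "k \<in> I" and "i \<noteq> k" and "T \<subseteq> J" and "card T = t"
  shows "congruent_sets Q (grid_point a b ` ({i, k} \<times> T))"
proof -
  obtain p q V where pq: "dist p q = a" and V: "card V = t" and Q: "Q = {p, q} \<times> V"
    and V_dist: "\<And>x y. \<lbrakk>x \<in> V; y \<in> V; x \<noteq> y\<rbrakk> \<Longrightarrow> dist x y = b"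
    using right_prism_verticesE[OF assms(1,2)] by blast
  have "p \<noteq> q" using pq assms(3) by auto
  \<comment> \<open>Infinite sets have \<open>card\<close> 0, so \<open>t \<ge> 1\<close> gives
    finiteness.\<close>
  have "finite V" "finite T" using V assms(2,12) by (auto intro: card_ge_0_finite)
  then obtain g where g: "bij_betw g V T" using finite_same_card_bij V assms(12) by metis
  define h where "h u = (if u = p then i else k)" for u
  define f where "f = (\<lambda>(u, v). grid_point a b (h u, g v))"
  have h_eq: "h u = h u' \<longleftrightarrow> u = u'" if "u \<in> {p, q}" "u' \<in> {p, q}" for u u'
    using that assms(10) \<open>p \<noteq> q\<close> by (auto simp: h_def)
  have g_eq: "g v = g v' \<longleftrightarrow> v = v'" if "v \<in> V" "v' \<in> V" for v v'
    using g that by (auto simp: bij_betw_def dest: inj_onD)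
  have iso: "dist (f z) (f z') = dist z z'" if "z \<in> Q" "z' \<in> Q" for z z'
  proof -
    obtain u v u' v' where z: "z = (u, v)" "z' = (u', v')" by (meson surj_pair)
    then have uv: "u \<in> {p, q}" "u' \<in> {p, q}" "v \<in> V" "v' \<in> V" using that Q by auto
    have "dist u u' = (if u = u' then 0 else a)" using uv(1,2) pq by (auto simp: dist_commute)
    moreover have "dist v v' = (if v = v' then 0 else b)" using uv(3,4) V_dist by auto
    moreover have "h u \<in> I" "h u' \<in> I" using assms(8,9) by (auto simp: h_def)
    moreover have "g v \<in> J" "g v' \<in> J" using g uv(3,4) assms(11) by (auto simp: bij_betw_def)
    ultimately show ?thesis
      using dist_grid_point[OF assms(5-7), of a b "h u" "h u'" "g v" "g v'"] assms(3,4) uv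
      by (simp add: z f_def dist_Pair_Pair h_eq g_eq)
  qed
  then have "inj_on f Q" by (metis dist_eq_0_iff inj_onI)
  moreover have "f ` Q = grid_point a b ` ({i, k} \<times> T)"
  proof -
    have "h ` {p, q} = {i, k}" using \<open>p \<noteq> q\<close> by (auto simp: h_def)
    moreover have "g ` V = T" using g by (simp add: bij_betw_def)
    ultimately have "map_prod h g ` Q = {i, k} \<times> T" unfolding Q by (metis map_prod_surj_on)
    moreover have "f = grid_point a b \<circ> map_prod h g" by (auto simp: f_def)
    ultimately show ?thesis by (metis image_comp)
  qed
  ultimately show ?thesis using iso unfolding congruent_sets_def bij_betw_def by blast
qed

section \<open>Splitting the basis of the space into rows and columns\<close>

theorem theorem6:
  fixes t r :: nat and a b :: real
    and Q :: "(real \<times> 'b::euclidean_space) set"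
    and c :: "'e::euclidean_space \<Rightarrow> nat"
  assumes "t \<ge> 2" and "r \<ge> 1" and "a > 0" and "b > 0"
    and "DIM('b) = t - 1"
    and "right_prism_vertices t a b Q"
    and "DIM('e) = (6 * (t - 1) - 1) * r + 3 * (t - 1) * (r + 1)
                     + 2 * (t - 1) * ((6 * (t - 1)) choose 2) + 3"
    and "\<forall>x. c x \<in> {1..r}"
  shows "(\<exists>S. congruent_sets Q S \<and> rainbow c S) \<or>
         (\<exists>S. congruent_sets Q S \<and> monochromatic c S)"
proof -
  define s where "s = t - 1"
  have s: "s \<ge> 1" "t = s + 1" using assms(1) by (auto simp: s_def)
  have dim: "card (Basis :: 'e set) = (6 * s - 1) * r + 3 * s * (r + 1) + 2 * s * ((6 * s) choose 2) + 3"
    using assms(7) by (simp add: s_def)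
  \<comment> \<open>The term with \<open>6 * s - 1\<close> and 2 of the final 3 dimensions supply
    the rows; all other basis vectors serve as columns.\<close>
  then have "(6 * s - 1) * r + 2 \<le> card (Basis :: 'e set)" by linarith
  then obtain I :: "'e set" where I: "I \<subseteq> Basis" "card I = (6 * s - 1) * r + 2"
    by (rule obtain_subset_with_card_n)
  define J where "J = (Basis :: 'e set) - I"
  have J: "J \<subseteq> Basis" "I \<inter> J = {}" by (auto simp: J_def)
  have fin: "finite I" "finite J" using finite_subset[OF I(1) finite_Basis] by (auto simp: J_def)
  have "card J = 3 * s * (r + 1) + 2 * s * ((6 * s) choose 2) + 1"
    unfolding J_def using card_Diff_subset[OF fin(1) I(1)] I(2) dim by simp
  \<comment> \<open>The last remaining dimension makes the column bound strict.\<close>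
  then have cardJ: "3 * s * card {1..r} + 2 * s * ((6 * s) choose 2) < card J" by simp
  obtain i k T where ikT: "i \<in> I" "k \<in> I" "i \<noteq> k" "T \<subseteq> J" "card T = s + 1"
    and disj: "(\<exists>x. \<forall>j\<in>T. c (grid_point a b (i, j)) = x \<and> c (grid_point a b (k, j)) = x) \<or>
      inj_on (\<lambda>(l, j). c (grid_point a b (l, j))) ({i, k} \<times> T)"
  proof (rule grid_monochromatic_or_rainbow[OF fin, of "{1..r}" s "\<lambda>i j. c (grid_point a b (i, j))"])
    show "(6 * s - 1) * card {1..r} + 2 \<le> card I" using I(2) by simp
  qed (use assms(2,8) s(1) cardJ in auto)
  let ?S = "grid_point a b ` ({i, k} \<times> T)"
  have "congruent_sets Q ?S"
    using prism_congruent_grid[OF assms(6) _ assms(3,4) I(1) J] ikT s by simp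
  moreover have "rainbow c ?S \<or> monochromatic c ?S"
    using disj
  proof
    assume "inj_on (\<lambda>(l, j). c (grid_point a b (l, j))) ({i, k} \<times> T)"
    moreover have "(\<lambda>(l, j). c (grid_point a b (l, j))) = c \<circ> grid_point a b" by auto
    ultimately have "inj_on c ?S" by (simp only: inj_on_imageI)
    then have "rainbow c ?S" by (auto simp: rainbow_def dest: inj_onD)
    then show ?thesis ..
  next
    assume "\<exists>x. \<forall>j\<in>T. c (grid_point a b (i, j)) = x \<and> c (grid_point a b (k, j)) = x"
    then have "monochromatic c ?S" unfolding monochromatic_def by auto
    then show ?thesis ..
  qed
  ultimately show ?thesis by blast
qed

end
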